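(* Let $\star$ be the star product on $\mathbb{C}_q[t_{41},t_{42},t_{31},t_{32}]$ defined in the context, set $q=e^h$, and for $f,g\in\mathbb{C}[t_{41},t_{42},t_{31},t_{32}]$ let $C_1(f,g)$ be the coefficient of $h$ in $f\star g$. Write $\partial_{ai}=\partial/\partial t_{ai}$. Then $$C_1(f,g)=-\big(t_{41}t_{31}\,\partial_{31}f\,\partial_{41}g+t_{42}t_{41}\,\partial_{42}f\,\partial_{41}g+t_{32}t_{42}\,\partial_{32}f\,\partial_{42}g+t_{32}t_{31}\,\partial_{32}f\,\partial_{31}g+2t_{42}t_{31}\,\partial_{32}f\,\partial_{41}g\big).$$ Its antisymmetrization $\{f,g\}=C_1(f,g)-C_1(g,f)$ is a Poisson bracket, given by $$\begin{aligned}\{f,g\}={}&t_{41}t_{31}(\partial_{41}f\,\partial_{31}g-\partial_{41}g\,\partial_{31}f)+t_{42}t_{41}(\partial_{41}f\,\partial_{42}g-\partial_{41}g\,\partial_{42}f)\\&+t_{32}t_{42}(\partial_{42}f\,\partial_{32}g-\partial_{42}g\,\partial_{32}f)+t_{32}t_{31}(\partial_{31}f\,\partial_{32}g-\partial_{31}g\,\partial_{32}f)\\&+2t_{42}t_{31}(\partial_{41}f\,\partial_{32}g-\partial_{41}g\,\partial_{32}f).\end{aligned}$$ In the coordinates $x^0=\tfrac12(t_{31}+t_{42})$, $x^1=\tfrac12(t_{32}+t_{41})$, $x^2=\tfrac{i}{2}(t_{32}-t_{41})$, $x^3=\tfrac12(t_{31}-t_{42})$, with $\partial_\mu=\partial/\partial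 x^\mu$, it reads $$\begin{aligned}\{f,g\}=i\Big(&\big((x^0)^2-(x^3)^2\big)(\partial_1f\,\partial_2g-\partial_1g\,\partial_2f)+x^0x^1(\partial_0f\,\partial_2g-\partial_0g\,\partial_2f)\\&-x^0x^2(\partial_0f\,\partial_1g-\partial_0g\,\partial_1f)-x^1x^3(\partial_2f\,\partial_3g-\partial_2g\,\partial_3f)+x^2x^3(\partial_1f\,\partial_3g-\partial_1g\,\partial_3f)\Big).\end{aligned}$$
   Context: Let $\mathbb{C}_q=\mathbb{C}[q,q^{-1}]$. The quantum Minkowski space $\mathcal{O}_q(\mathrm{M})$ is the associative unital $\mathbb{C}_q$-algebra generated by $\hat t_{41},\hat t_{42},\hat t_{31},\hat t_{32}$ subject to the relations $$\hat t_{42}\hat t_{41}=q^{-1}\hat t_{41}\hat t_{42},\quad \hat t_{31}\hat t_{41}=q^{-1}\hat t_{41}\hat t_{31},\quad \hat t_{32}\hat t_{41}=\hat t_{41}\hat t_{32}+(q^{-1}-q)\hat t_{42}\hat t_{31},$$ $$\hat t_{31}\hat t_{42}=\hat t_{42}\hat t_{31},\quad \hat t_{32}\hat t_{42}=q^{-1}\hat t_{42}\hat t_{32},\quad \hat t_{32}\hat t_{31}=q^{-1}\hat t_{31}\hat t_{32}.$$ It is known that the $\mathbb{C}_q$-linear map $$Q:\mathbb{C}_q[t_{41},t_{42},t_{31},t_{32}]\to\mathcal{O}_q(\mathrm{M}),\qquad t_{41}^a t_{42}^b t_{31}^c t_{32}^d\mapsto \hat t_{41}^a\hat t_{42}^b\hat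 t_{31}^c\hat t_{32}^d,$$ from the commutative polynomial ring is an isomorphism of $\mathbb{C}_q$-modules. The star product is $f\star g=Q^{-1}(Q(f)Q(g))$. For $f,g$ polynomials with coefficients in $\mathbb{C}$, the coefficients of $f\star g$ are Laurent polynomials in $q$, which become formal power series in $h$ upon setting $q=e^h$. *)

theory Defs
  imports Complex_Main
    "HOL-Library.Poly_Mapping"
    "HOL-Computational_Algebra.Formal_Power_Series"
begin

section \<open>Multivariate polynomials\<close>

text \<open>Polynomials with variables of type \<open>'v\<close> are finitely supported maps from exponent
  vectors to coefficients; multiplication is the convolution product of
  \<^theory>\<open>HOL-Library.Poly_Mapping\<close>.\<close>

type_synonym ('v, 'a) mpoly = "('v \<Rightarrow>\<^sub>0 nat) \<Rightarrow>\<^sub>0 'a"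

definition Const :: "'a \<Rightarrow> ('v, 'a::comm_ring_1) mpoly" where
  "Const c = Poly_Mapping.single 0 c"

definition Var :: "'v \<Rightarrow> ('v, 'a::comm_ring_1) mpoly" where
  "Var v = Poly_Mapping.single (Poly_Mapping.single v 1) 1"

text \<open>If \<open>v\<close> does not occur in the exponent vector \<open>m\<close>, the truncated subtraction below is harmless,
  since the coefficient is then 0.\<close>

definition pdiff :: "'v \<Rightarrow> ('v, 'a::comm_ring_1) mpoly \<Rightarrow> ('v, 'a) mpoly" ("\<partial>") where
  "\<partial> v p = (\<Sum>m\<in>Poly_Mapping.keys p.
     Poly_Mapping.single (m - Poly_Mapping.single v 1)
       (of_nat (Poly_Mapping.lookup m v) * Poly_Mapping.lookup p m))"

definition psubst :: "('v \<Rightarrow> ('w, 'a) mpoly) \<Rightarrow> ('v, 'a::comm_ring_1) mpoly \<Rightarrow> ('w, 'a) mpoly" where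
  "psubst \<sigma> p = (\<Sum>m\<in>Poly_Mapping.keys p.
     Const (Poly_Mapping.lookup p m) * (\<Prod>v\<in>Poly_Mapping.keys m. \<sigma> v ^ Poly_Mapping.lookup m v))"

text \<open>Poisson brackets on a complex polynomial algebra: bilinear, antisymmetric, satisfying the
  Jacobi identity and the Leibniz rule. Linearity and the Leibniz rule in the second argument follow
  by antisymmetry.\<close>

definition poisson_bracket ::
  "(('v, complex) mpoly \<Rightarrow> ('v, complex) mpoly \<Rightarrow> ('v, complex) mpoly) \<Rightarrow> bool" where
  "poisson_bracket B \<longleftrightarrow>
     (\<forall>f g h. B (f + g) h = B f h + B g h) \<and>
     (\<forall>c f g. B (Const c * f) g = Const c * B f g) \<and>
     (\<forall>f g. B f g = - B g f) \<and>
     (\<forall>f g h. B f (B g h) + B g (B h f) + B h (B f g) = 0) \<and>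
     (\<forall>f g h. B (f * g) h = f * B g h + B f h * g)"


section \<open>Laurent polynomials\<close>

text \<open>\<open>\<complex>[q, q\<^sup>-\<^sup>1]\<close> is the group algebra of the integers; \<open>single k c\<close> is \<open>c q\<^sup>k\<close>.\<close>

type_synonym laurent = "int \<Rightarrow>\<^sub>0 complex"

definition q :: laurent where "q = Poly_Mapping.single 1 1"

definition q_inv :: laurent where "q_inv = Poly_Mapping.single (-1) 1"

lemma q_q_inv: "q * q_inv = 1"
  by (simp add: q_def q_inv_def mult_single)

text \<open>The expansion in \<open>h\<close> under \<open>q = e\<^sup>h\<close>.\<close>

definition h_expansion :: "laurent \<Rightarrow> complex fps" where
  "h_expansion p = (\<Sum>k\<in>Poly_Mapping.keys p.
     fps_const (Poly_Mapping.lookup p k) * fps_exp (of_int k))"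


section \<open>Quantum Minkowski space\<close>

datatype gen = T41 | T42 | T31 | T32

datatype word = Word (letters: "gen list")

instantiation word :: monoid_add
begin

definition zero_word :: word where "0 = Word []"

definition plus_word :: "word \<Rightarrow> word \<Rightarrow> word" where
  "v + w = Word (letters v @ letters w)"

instance
  by standard (simp_all add: zero_word_def plus_word_def)

end

text \<open>The free unital associative algebra over Laurent polynomials is the monoid algebra of words.\<close>

type_synonym free_alg = "word \<Rightarrow>\<^sub>0 laurent"

definition scalar :: "laurent \<Rightarrow> free_alg" where
  "scalar c = Poly_Mapping.single 0 c"

definition letter :: "gen \<Rightarrow> free_alg" where
  "letter v = Poly_Mapping.single (Word [v]) 1"

definition relators :: "free_alg set" where
  "relators =
    {letter T42 * letter T41 - scalar q_inv * letter T41 * letter T42,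
     letter T31 * letter T41 - scalar q_inv * letter T41 * letter T31,
     letter T32 * letter T41 - (letter T41 * letter T32
        + scalar (q_inv - q) * letter T42 * letter T31),
     letter T31 * letter T42 - letter T42 * letter T31,
     letter T32 * letter T42 - scalar q_inv * letter T42 * letter T32,
     letter T32 * letter T31 - scalar q_inv * letter T31 * letter T32}"

inductive_set relation_ideal :: "free_alg set" where
  base: "r \<in> relators \<Longrightarrow> r \<in> relation_ideal"
| zero: "0 \<in> relation_ideal"
| add: "a \<in> relation_ideal \<Longrightarrow> b \<in> relation_ideal \<Longrightarrow> a + b \<in> relation_ideal"
| mult_left: "b \<in> relation_ideal \<Longrightarrow> a * b \<in> relation_ideal"
| mult_right: "a \<in> relation_ideal \<Longrightarrow> a * b \<in> relation_ideal"

lemma relation_ideal_uminus: "a \<in> relation_ideal \<Longrightarrow> - a \<in> relation_ideal"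
  using relation_ideal.mult_left[of a "- 1"] by simp

lemma word_plus_eq_0: "(v::word) + w = 0 \<longleftrightarrow> v = 0 \<and> w = 0"
  by (cases v; cases w) (simp add: zero_word_def plus_word_def)

lemma lookup_free_alg_times_0:
  fixes a b :: free_alg
  shows "Poly_Mapping.lookup (a * b) 0 = Poly_Mapping.lookup a 0 * Poly_Mapping.lookup b 0"
proof -
  have *: "(\<Sum>w. Poly_Mapping.lookup b w when (0::word) = v + w)
      = (Poly_Mapping.lookup b 0 when v = 0)" for v
  proof -
    have "(\<Sum>w. Poly_Mapping.lookup b w when (0::word) = v + w)
        = (\<Sum>w. (Poly_Mapping.lookup b 0 when v = 0) when w = (0::word))"
    proof (rule Sum_any.cong)
      fix w
      have "0 = v + w \<longleftrightarrow> v = 0 \<and> w = 0"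
        using word_plus_eq_0[of v w] by metis
      then show "(Poly_Mapping.lookup b w when (0::word) = v + w)
          = ((Poly_Mapping.lookup b 0 when v = 0) when w = 0)"
        by (auto simp: when_def)
    qed
    then show ?thesis by simp
  qed
  have "Poly_Mapping.lookup (a * b) 0
      = (\<Sum>v. Poly_Mapping.lookup a v * (Poly_Mapping.lookup b 0 when v = 0))"
    by (simp only: lookup_mult *)
  also have "\<dots> = (\<Sum>v. (Poly_Mapping.lookup a 0 * Poly_Mapping.lookup b 0) when v = (0::word))"
    by (rule Sum_any.cong) (auto simp: when_def)
  finally show ?thesis by simp
qed

lemma lookup_relation_ideal_0: "a \<in> relation_ideal \<Longrightarrow> Poly_Mapping.lookup a 0 = 0"
proof (induction rule: relation_ideal.induct)
  case (base r)
  have "Poly_Mapping.lookup (letter v) 0 = 0" for v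
    by (simp add: letter_def lookup_single when_def zero_word_def)
  with base show ?case
    by (auto simp: relators_def lookup_minus lookup_add lookup_free_alg_times_0)
qed (simp_all add: lookup_add lookup_free_alg_times_0)

lemma one_notin_relation_ideal: "1 \<notin> relation_ideal"
  using lookup_relation_ideal_0[of 1] by (auto simp: lookup_one)

definition ideal_cong :: "free_alg \<Rightarrow> free_alg \<Rightarrow> bool" where
  "ideal_cong a b \<longleftrightarrow> a - b \<in> relation_ideal"

lemma equivp_ideal_cong: "equivp ideal_cong"
proof (rule equivpI)
  show "reflp ideal_cong"
    by (simp add: reflp_def ideal_cong_def relation_ideal.zero)
  show "symp ideal_cong"
    unfolding symp_def ideal_cong_def by (metis relation_ideal_uminus minus_diff_eq)
  show "transp ideal_cong"
  proof (rule transpI)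
    fix a b c assume "ideal_cong a b" "ideal_cong b c"
    then have "(a - b) + (b - c) \<in> relation_ideal"
      unfolding ideal_cong_def by (rule relation_ideal.add)
    then show "ideal_cong a c" by (simp add: ideal_cong_def)
  qed
qed

quotient_type qmink = free_alg / ideal_cong
  by (rule equivp_ideal_cong)

lemma ideal_cong_add:
  "ideal_cong a a' \<Longrightarrow> ideal_cong b b' \<Longrightarrow> ideal_cong (a + b) (a' + b')"
  unfolding ideal_cong_def by (metis relation_ideal.add add_diff_add)

lemma ideal_cong_uminus: "ideal_cong a a' \<Longrightarrow> ideal_cong (- a) (- a')"
  unfolding ideal_cong_def by (drule relation_ideal_uminus) (simp add: algebra_simps)

lemma ideal_cong_mult:
  assumes "ideal_cong a a'" "ideal_cong b b'"
  shows "ideal_cong (a * b) (a' * b')"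
proof -
  have "a * b - a' * b' = a * (b - b') + (a - a') * b'"
    by (simp add: algebra_simps)
  with assms show ?thesis
    unfolding ideal_cong_def
    by (simp add: relation_ideal.add relation_ideal.mult_left relation_ideal.mult_right)
qed

instantiation qmink :: ring_1
begin

lift_definition zero_qmink :: qmink is 0 .

lift_definition one_qmink :: qmink is 1 .

lift_definition plus_qmink :: "qmink \<Rightarrow> qmink \<Rightarrow> qmink" is "(+)"
  by (rule ideal_cong_add)

lift_definition uminus_qmink :: "qmink \<Rightarrow> qmink" is uminus
  by (rule ideal_cong_uminus)

lift_definition minus_qmink :: "qmink \<Rightarrow> qmink \<Rightarrow> qmink" is "(-)"
  using ideal_cong_add[OF _ ideal_cong_uminus] by simp

lift_definition times_qmink :: "qmink \<Rightarrow> qmink \<Rightarrow> qmink" is "(*)"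
  by (rule ideal_cong_mult)

instance
proof
  show "(0::qmink) \<noteq> 1"
    by transfer (metis ideal_cong_def one_notin_relation_ideal relation_ideal_uminus diff_0
        minus_minus)
qed (transfer, simp add: algebra_simps equivp_reflp[OF equivp_ideal_cong])+

end

lift_definition qscale :: "laurent \<Rightarrow> qmink \<Rightarrow> qmink" is "\<lambda>c a. scalar c * a"
  by (rule ideal_cong_mult) (simp_all add: equivp_reflp[OF equivp_ideal_cong])

lift_definition that :: "gen \<Rightarrow> qmink" is letter .

lemma qscale_eq_mult: "qscale c a = qscale c 1 * a"
  by transfer (simp add: equivp_reflp[OF equivp_ideal_cong])

lemma qscale_mult_left: "qscale c a * b = qscale c (a * b)"
  by transfer (simp add: mult.assoc equivp_reflp[OF equivp_ideal_cong])

lemma scalar_commute: "scalar c * a = a * scalar c"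
proof (induction a rule: update_induct)
  case (update f w d)
  have "Poly_Mapping.update w d f = f + Poly_Mapping.single w d"
    using update.hyps
    by (intro poly_mapping_eqI)
      (auto simp: lookup_update lookup_add lookup_single when_def in_keys_iff)
  moreover have "scalar c * Poly_Mapping.single w d = Poly_Mapping.single w d * scalar c"
    by (simp add: scalar_def mult_single mult.commute)
  ultimately show ?case
    using update by (simp add: distrib_left distrib_right)
qed simp

lemma mult_qscale_right: "a * qscale c b = qscale c (a * b)"
  by transfer (metis scalar_commute mult.assoc equivp_reflp[OF equivp_ideal_cong])

lemma relator_cong: "a - b \<in> relators \<Longrightarrow> ideal_cong a b"
  by (simp add: ideal_cong_def relation_ideal.base)

lemma qmink_relations:
  "that T42 * that T41 = qscale q_inv (that T41 * that T42)"
  "that T31 * that T41 = qscale q_inv (that T41 * that T31)"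
  "that T32 * that T41 = that T41 * that T32 + qscale (q_inv - q) (that T42 * that T31)"
  "that T31 * that T42 = that T42 * that T31"
  "that T32 * that T42 = qscale q_inv (that T42 * that T32)"
  "that T32 * that T31 = qscale q_inv (that T31 * that T32)"
  by (transfer, rule relator_cong, simp add: relators_def mult.assoc)+

text \<open>The normal-ordering map, with the generators ordered as \<open>t41, t42, t31, t32\<close>.\<close>

definition Q :: "(gen, laurent) mpoly \<Rightarrow> qmink" where
  "Q f = (\<Sum>m\<in>Poly_Mapping.keys f. qscale (Poly_Mapping.lookup f m)
     (that T41 ^ Poly_Mapping.lookup m T41 * that T42 ^ Poly_Mapping.lookup m T42 *
      that T31 ^ Poly_Mapping.lookup m T31 * that T32 ^ Poly_Mapping.lookup m T32))"


section \<open>The star product and its first-order term\<close>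

definition star :: "(gen, laurent) mpoly \<Rightarrow> (gen, laurent) mpoly \<Rightarrow> (gen, laurent) mpoly"
  (infixl "\<star>" 70) where
  "f \<star> g = inv Q (Q f * Q g)"

definition base_change :: "(gen, complex) mpoly \<Rightarrow> (gen, laurent) mpoly" where
  "base_change f = Poly_Mapping.map (\<lambda>c. Poly_Mapping.single 0 c) f"

definition C\<^sub>1 :: "(gen, complex) mpoly \<Rightarrow> (gen, complex) mpoly \<Rightarrow> (gen, complex) mpoly" where
  "C\<^sub>1 f g = Poly_Mapping.map (\<lambda>c. fps_nth (h_expansion c) 1) (base_change f \<star> base_change g)"

definition pbr :: "(gen, complex) mpoly \<Rightarrow> (gen, complex) mpoly \<Rightarrow> (gen, complex) mpoly" where
  "pbr f g = C\<^sub>1 f g - C\<^sub>1 g f"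

abbreviation t41 :: "(gen, complex) mpoly" where "t41 \<equiv> Var T41"
abbreviation t42 :: "(gen, complex) mpoly" where "t42 \<equiv> Var T42"
abbreviation t31 :: "(gen, complex) mpoly" where "t31 \<equiv> Var T31"
abbreviation t32 :: "(gen, complex) mpoly" where "t32 \<equiv> Var T32"


section \<open>Space-time coordinates\<close>

datatype coord = X0 | X1 | X2 | X3

primrec xc :: "coord \<Rightarrow> (gen, complex) mpoly" where
  "xc X0 = Const (1/2) * (t31 + t42)"
| "xc X1 = Const (1/2) * (t32 + t41)"
| "xc X2 = Const (\<i>/2) * (t32 - t41)"
| "xc X3 = Const (1/2) * (t31 - t42)"

text \<open>\<open>in_coords F\<close> is the polynomial in the \<open>t\<close>'s whose expression in the coordinates \<open>x\<close> is \<open>F\<close>;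
  \<open>\<partial>x \<mu>\<close> differentiates that expression with respect to its variable \<open>\<mu>\<close>.\<close>

definition in_coords :: "(coord, complex) mpoly \<Rightarrow> (gen, complex) mpoly" where
  "in_coords = psubst xc"

definition pdiff_x :: "coord \<Rightarrow> (gen, complex) mpoly \<Rightarrow> (gen, complex) mpoly" ("\<partial>x") where
  "\<partial>x \<mu> f = in_coords (\<partial> \<mu> (inv in_coords f))"

end

(* Normal ordering is surjective, so f \<star> g, although defined through inv Q, does satisfy
   Q (f \<star> g) = Q f * Q g; injectivity of Q is not needed for the first-order term.  The claimed C\<^sub>1
   is a biderivation B, so f g + h B(f, g) is an associative product modulo h^2, and the generators
   satisfy the quantum relations for it at q = 1 + h.  The resulting ring homomorphism from the
   quantum Minkowski space sends Q F to the 1-jet of F, because B vanishes between the factors of a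
   normally ordered monomial; applying it to Q (f \<star> g) = Q f * Q g reads off C\<^sub>1 = B. *)
theory Submission
  imports Defs
begin

section \<open>Linear extension and induction\<close>

text \<open>Inserting a coefficient at a fresh key amounts to adding a single term, so sums of terms
  exhaust all finitely supported maps.\<close>

lemma poly_mapping_add_induct [case_names single add]:
  fixes p :: "'k \<Rightarrow>\<^sub>0 'a::monoid_add"
  assumes single: "\<And>k c. P (Poly_Mapping.single k c)"
    and add: "\<And>a b. P a \<Longrightarrow> P b \<Longrightarrow> P (a + b)"
  shows "P p"
proof (induction p rule: update_induct)
  case const
  show ?case using single[of undefined 0] by simp
next
  case (update f w d)
  have "Poly_Mapping.update w d f = f + Poly_Mapping.single w d"
    using update.hyps
    by (intro poly_mapping_eqI)
      (auto simp: lookup_update lookup_add lookup_single when_def in_keys_iff)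
  with update.IH single add show ?case by simp
qed

text \<open>Common form of \<open>pdiff\<close>, \<open>psubst\<close>, \<open>h_expansion\<close>,
  \<open>Q\<close> and the jet evaluation below. \<open>F\<close> takes the coefficient as an
  argument because source and target may have different scalars.\<close>

definition lin_ext :: "('k \<Rightarrow> 'a::zero \<Rightarrow> 'b::comm_monoid_add) \<Rightarrow> ('k \<Rightarrow>\<^sub>0 'a) \<Rightarrow> 'b" where
  "lin_ext F p = (\<Sum>k\<in>Poly_Mapping.keys p. F k (Poly_Mapping.lookup p k))"

lemma lin_ext_superset:
  assumes "\<And>k. F k 0 = 0" "finite S" "Poly_Mapping.keys p \<subseteq> S"
  shows "lin_ext F p = (\<Sum>k\<in>S. F k (Poly_Mapping.lookup p k))"
  unfolding lin_ext_def using assms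
  by (intro sum.mono_neutral_left) (auto simp: in_keys_iff)

lemma lin_ext_single: "(\<And>k. F k 0 = 0) \<Longrightarrow> lin_ext F (Poly_Mapping.single k c) = F k c"
  by (simp add: lin_ext_def)

lemma lin_ext_add:
  assumes "\<And>k. F k 0 = 0" "\<And>k a b. F k (a + b) = F k a + F k b"
  shows "lin_ext F (p + p') = lin_ext F p + lin_ext F p'"
proof -
  let ?S = "Poly_Mapping.keys p \<union> Poly_Mapping.keys p'"
  have "Poly_Mapping.keys (p + p') \<subseteq> ?S" by (rule keys_add)
  then show ?thesis
    using assms by (simp add: lin_ext_superset[of F ?S] lookup_add sum.distrib)
qed

text \<open>Universal property of the monoid algebra: additivity reduces the claim to pairs of
  terms. The target may be noncommutative; any commutation of scalars with monomials is hidden in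
  \<open>mult\<close>.\<close>

lemma lin_ext_mult:
  fixes F :: "'k::monoid_add \<Rightarrow> 'a::semiring_0 \<Rightarrow> 'b::semiring_0"
  assumes zero: "\<And>k. F k 0 = 0" and add: "\<And>k a b. F k (a + b) = F k a + F k b"
    and mult: "\<And>k l a b. F (k + l) (a * b) = F k a * F l b"
  shows "lin_ext F (p * p') = lin_ext F p * lin_ext F p'"
proof (induction p rule: poly_mapping_add_induct)
  case (single k c)
  show ?case
    by (induction p' rule: poly_mapping_add_induct)
      (simp_all add: mult_single lin_ext_single lin_ext_add zero add mult distrib_left)
qed (simp add: distrib_right lin_ext_add zero add)

section \<open>Polynomial rings\<close>

lemma Const_simps [simp]: "Const 0 = 0" "Const 1 = 1"
  by (simp_all add: Const_def)

lemma Const_add: "Const (a + b) = Const a + Const b"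
  by (simp add: Const_def single_add)

lemma Const_mult: "Const (a * b) = Const a * Const b"
  by (simp add: Const_def mult_single)

lemma Const_uminus: "Const (- a) = - Const a"
  by (simp add: Const_def single_uminus)

lemma Const_mult_single: "Const c * Poly_Mapping.single m d = Poly_Mapping.single m (c * d)"
  by (simp add: Const_def mult_single)

lemma Var_power: "Var v ^ n = Poly_Mapping.single (Poly_Mapping.single v n) 1"
  by (induction n) (simp_all add: Var_def mult_single single_add[symmetric])

lemma mpoly_induct [case_names Const Var add mult]:
  fixes p :: "('v, 'a::comm_ring_1) mpoly"
  assumes Const: "\<And>c. P (Const c)" and Var: "\<And>v. P (Var v)"
    and add: "\<And>a b. P a \<Longrightarrow> P b \<Longrightarrow> P (a + b)"
    and mult: "\<And>a b. P a \<Longrightarrow> P b \<Longrightarrow> P (a * b)"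
  shows "P p"
proof (induction p rule: poly_mapping_add_induct)
  case (single m c)
  have "P (Poly_Mapping.single m 1)"
  \<comment> \<open>An exponent vector is itself a finitely supported map, so the same induction
    builds it from powers of single variables.\<close>
  proof (induction m rule: poly_mapping_add_induct)
    case (single v n)
    have "P (Var v ^ n)"
      using Const[of 1] by (induction n) (simp_all add: Var mult)
    then show ?case by (simp add: Var_power)
  next
    case (add m n)
    then show ?case using mult[of "Poly_Mapping.single m 1" "Poly_Mapping.single n 1"]
      by (simp add: mult_single)
  qed
  with Const[of c] have "P (Const c * Poly_Mapping.single m 1)" by (rule mult)
  then show ?case by (simp add: Const_mult_single)
qed (rule add)

section \<open>Formal partial derivatives\<close>

lemma pdiff_lin_ext: "\<partial> v = lin_ext (\<lambda>m c.
    Poly_Mapping.single (m - Poly_Mapping.single v 1) (of_nat (Poly_Mapping.lookup m v) * c))"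
  by (simp add: fun_eq_iff pdiff_def lin_ext_def)

lemma pdiff_single: "\<partial> v (Poly_Mapping.single m c) =
    Poly_Mapping.single (m - Poly_Mapping.single v 1) (of_nat (Poly_Mapping.lookup m v) * c)"
  by (simp add: pdiff_lin_ext lin_ext_single)

lemma pdiff_add [simp]: "\<partial> v (f + g) = \<partial> v f + \<partial> v g"
  by (simp add: pdiff_lin_ext lin_ext_add distrib_left single_add)

lemma pdiff_Const [simp]: "\<partial> v (Const c) = 0"
  by (simp add: Const_def pdiff_single)

lemma pdiff_0 [simp]: "\<partial> v 0 = 0" and pdiff_1 [simp]: "\<partial> v 1 = 0"
  using pdiff_Const[of v 0] pdiff_Const[of v 1] by (simp_all del: pdiff_Const)

lemma pdiff_uminus [simp]: "\<partial> v (- f) = - \<partial> v f"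
  using pdiff_add[of v f "- f"] by (simp add: eq_neg_iff_add_eq_0 add.commute del: pdiff_add)

lemma pdiff_diff [simp]: "\<partial> v (f - g) = \<partial> v f - \<partial> v g"
  using pdiff_add[of v f "- g"] by simp

lemma pdiff_Var [simp]: "\<partial> v (Var w) = (if v = w then 1 else 0)"
  by (auto simp: Var_def pdiff_single lookup_single)

text \<open>When \<open>v\<close> occurs in \<open>m\<close>, the truncated subtraction commutes
  with adding \<open>n\<close>; otherwise the coefficient makes both sides zero.\<close>

lemma single_minus_lookup:
  "Poly_Mapping.single (m - Poly_Mapping.single v 1 + n) (of_nat (Poly_Mapping.lookup m v) * c)
   = Poly_Mapping.single (m + n - Poly_Mapping.single v (1::nat))
       (of_nat (Poly_Mapping.lookup m v) * (c::'a::comm_ring_1))"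
proof (cases "Poly_Mapping.lookup m v = 0")
  case False
  then have "m - Poly_Mapping.single v 1 + n = m + n - Poly_Mapping.single v 1"
    by (intro poly_mapping_eqI) (auto simp: lookup_add lookup_minus lookup_single when_def)
  then show ?thesis by simp
qed simp

lemma pdiff_mult [simp]: "\<partial> v (f * g) = f * \<partial> v g + \<partial> v f * g"
proof (induction f rule: poly_mapping_add_induct)
  case (single m c)
  show ?case
  proof (induction g rule: poly_mapping_add_induct)
    case (single n d)
    \<comment> \<open>The exponent of \<open>v\<close> in the product is the sum of its exponents in
      the factors; each summand gives one Leibniz term.\<close>
    show ?case
      using single_minus_lookup[of m v n "c * d"] single_minus_lookup[of n v m "c * d"]
      by (simp add: pdiff_single mult_single lookup_add add.commute mult_ac distrib_left
          single_add)
  qed (simp add: algebra_simps)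
qed (simp add: algebra_simps)

lemma pdiff_power_zero: "\<partial> v f = 0 \<Longrightarrow> \<partial> v (f ^ n) = 0"
  by (induction n) simp_all

section \<open>Substitution homomorphisms\<close>

lemma monom_prod_superset:
  assumes "finite S" "Poly_Mapping.keys m \<subseteq> S"
  shows "(\<Prod>v\<in>Poly_Mapping.keys m. \<sigma> v ^ Poly_Mapping.lookup m v)
    = (\<Prod>v\<in>S. (\<sigma> v ^ Poly_Mapping.lookup m v :: 'a::comm_monoid_mult))"
  using assms by (intro prod.mono_neutral_left) (auto simp: in_keys_iff)

lemma monom_prod_add:
  fixes \<sigma> :: "'v \<Rightarrow> 'a::comm_monoid_mult"
  shows "(\<Prod>v\<in>Poly_Mapping.keys (m + n). \<sigma> v ^ Poly_Mapping.lookup (m + n) v)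
    = (\<Prod>v\<in>Poly_Mapping.keys m. \<sigma> v ^ Poly_Mapping.lookup m v)
    * (\<Prod>v\<in>Poly_Mapping.keys n. \<sigma> v ^ Poly_Mapping.lookup n v)"
proof -
  let ?S = "Poly_Mapping.keys m \<union> Poly_Mapping.keys n"
  have *: "(\<Prod>v\<in>Poly_Mapping.keys k. \<sigma> v ^ Poly_Mapping.lookup k v)
      = (\<Prod>v\<in>?S. \<sigma> v ^ Poly_Mapping.lookup k v)" if "Poly_Mapping.keys k \<subseteq> ?S" for k
    using that by (intro monom_prod_superset) simp_all
  show ?thesis
    unfolding *[OF keys_add] *[OF Un_upper1] *[OF Un_upper2]
    by (simp add: lookup_add power_add prod.distrib)
qed

lemma psubst_lin_ext: "psubst \<sigma> = lin_ext (\<lambda>m c.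
    Const c * (\<Prod>v\<in>Poly_Mapping.keys m. \<sigma> v ^ Poly_Mapping.lookup m v))"
  by (simp add: fun_eq_iff psubst_def lin_ext_def)

lemma psubst_add [simp]: "psubst \<sigma> (f + g) = psubst \<sigma> f + psubst \<sigma> g"
  by (simp add: psubst_lin_ext lin_ext_add Const_add distrib_right)

lemma psubst_mult [simp]: "psubst \<sigma> (f * g) = psubst \<sigma> f * psubst \<sigma> g"
  unfolding psubst_lin_ext
  by (rule lin_ext_mult) (simp_all add: Const_add distrib_right Const_mult monom_prod_add mult_ac)

lemma psubst_Const [simp]: "psubst \<sigma> (Const c) = Const c"
  by (simp add: psubst_lin_ext lin_ext_single Const_def)

lemma psubst_Var [simp]: "psubst \<sigma> (Var v) = \<sigma> v"
  by (simp add: psubst_lin_ext lin_ext_single Var_def)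

lemma psubst_0 [simp]: "psubst \<sigma> 0 = 0" and psubst_1 [simp]: "psubst \<sigma> 1 = 1"
  using psubst_Const[of \<sigma> 0] psubst_Const[of \<sigma> 1] by (simp_all del: psubst_Const)

lemma psubst_uminus [simp]: "psubst \<sigma> (- f) = - psubst \<sigma> f"
  using psubst_add[of \<sigma> f "- f"] by (simp add: eq_neg_iff_add_eq_0 add.commute del: psubst_add)

lemma psubst_diff [simp]: "psubst \<sigma> (f - g) = psubst \<sigma> f - psubst \<sigma> g"
  using psubst_add[of \<sigma> f "- g"] by simp

section \<open>Normal ordering is surjective\<close>

lemma qscale_add_left: "qscale (a + b) x = qscale a x + qscale b x"
  by transfer (simp add: scalar_def single_add distrib_right equivp_reflp[OF equivp_ideal_cong])

lemma qscale_add_right: "qscale a (x + y) = qscale a x + qscale a y"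
  by transfer (simp add: distrib_left equivp_reflp[OF equivp_ideal_cong])

lemma qscale_qscale: "qscale a (qscale b x) = qscale (a * b) x"
  by transfer (simp add: scalar_def mult.assoc[symmetric] mult_single
      equivp_reflp[OF equivp_ideal_cong])

lemma qscale_0_left [simp]: "qscale 0 x = 0"
  by transfer (simp add: scalar_def equivp_reflp[OF equivp_ideal_cong])

lemma qscale_1_left [simp]: "qscale 1 x = x"
  by transfer (simp add: scalar_def equivp_reflp[OF equivp_ideal_cong])

text \<open>Indexed by four exponents, so that multiplying by a generator shows as a change of an
  index.\<close>

definition normal_monom :: "nat \<Rightarrow> nat \<Rightarrow> nat \<Rightarrow> nat \<Rightarrow> qmink" where
  "normal_monom a b c d = that T41 ^ a * that T42 ^ b * that T31 ^ c * that T32 ^ d"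

lemma Q_lin_ext: "Q = lin_ext (\<lambda>m c. qscale c
    (normal_monom (Poly_Mapping.lookup m T41) (Poly_Mapping.lookup m T42)
       (Poly_Mapping.lookup m T31) (Poly_Mapping.lookup m T32)))"
  by (simp add: fun_eq_iff Q_def lin_ext_def normal_monom_def)

lemma Q_add: "Q (f + g) = Q f + Q g"
  by (simp add: Q_lin_ext lin_ext_add qscale_add_left)

lemma Q_Const_mult: "Q (Const c * f) = qscale c (Q f)"
proof (induction f rule: poly_mapping_add_induct)
  case (single m d)
  show ?case by (simp add: Q_lin_ext lin_ext_single Const_mult_single qscale_qscale)
qed (simp add: distrib_left Q_add qscale_add_right)

lemma range_Q_add: "x \<in> range Q \<Longrightarrow> y \<in> range Q \<Longrightarrow> x + y \<in> range Q"
  by (auto simp flip: Q_add)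

lemma range_Q_qscale: "x \<in> range Q \<Longrightarrow> qscale c x \<in> range Q"
  by (auto simp flip: Q_Const_mult)

lemma normal_monom_in_range_Q: "normal_monom a b c d \<in> range Q"
proof -
  let ?m = "Poly_Mapping.single T41 a + Poly_Mapping.single T42 b
    + Poly_Mapping.single T31 c + Poly_Mapping.single T32 d"
  have "Q (Poly_Mapping.single ?m 1) = normal_monom a b c d"
    by (simp add: Q_lin_ext lin_ext_single lookup_add lookup_single)
  then show ?thesis by (metis rangeI)
qed

text \<open>Scalars are central, so left multiplication by \<open>x\<close> is linear and needs
  checking only on the ordered monomials, which span the range.\<close>

lemma mult_range_QI:
  assumes "\<And>a b c d. x * normal_monom a b c d \<in> range Q" and "y \<in> range Q"
  shows "x * y \<in> range Q"
proof -
  have "x * Q f \<in> range Q" for f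
  proof (induction f rule: poly_mapping_add_induct)
    case (single m c)
    have "x * Q (Poly_Mapping.single m c) = qscale c (x * normal_monom
        (Poly_Mapping.lookup m T41) (Poly_Mapping.lookup m T42)
        (Poly_Mapping.lookup m T31) (Poly_Mapping.lookup m T32))"
      by (simp add: Q_lin_ext lin_ext_single mult_qscale_right)
    then show ?case by (simp add: range_Q_qscale assms(1))
  qed (simp add: Q_add distrib_left range_Q_add)
  with assms(2) show ?thesis by auto
qed

section \<open>Left multiplication of ordered monomials by generators\<close>

lemma mult_power_qcommute:
  assumes "x * y = qscale s (y * x)"
  shows "x * y ^ n = qscale (s ^ n) (y ^ n * x)"
proof (induction n)
  case (Suc n)
  have "x * y ^ Suc n = qscale s (y * (x * y ^ n))"
    by (simp add: mult.assoc[symmetric] assms qscale_mult_left)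
  then show ?case
    by (simp add: Suc mult_qscale_right qscale_qscale mult.assoc)
qed simp

text \<open>The relations that exchange two generators up to a scalar; plain commutation of
  \<open>T31\<close> and \<open>T42\<close> is read as exchange with scalar 1. The relation for
  \<open>T32\<close> and \<open>T41\<close> has a correction term and is not of this form.\<close>

lemmas qmink_power_relations =
  mult_power_qcommute[OF qmink_relations(1)]
  mult_power_qcommute[OF qmink_relations(2)]
  mult_power_qcommute[OF qmink_relations(4)[THEN trans, OF qscale_1_left[symmetric]]]
  mult_power_qcommute[OF qmink_relations(5)]
  mult_power_qcommute[OF qmink_relations(6)]

lemma mult_left_cong: "x * y = z \<Longrightarrow> x * (y * w) = z * (w::'a::semigroup_mult)"
  by (simp add: mult.assoc[symmetric])

lemma T41_mult_normal: "that T41 * normal_monom a b c d = normal_monom (Suc a) b c d"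
  by (simp add: normal_monom_def mult.assoc)

lemma T42_mult_normal:
  "that T42 * normal_monom a b c d = qscale (q_inv ^ a) (normal_monom a (Suc b) c d)"
  by (simp add: normal_monom_def mult.assoc mult_left_cong[OF qmink_power_relations(1)]
      qscale_mult_left)

lemma T31_mult_normal:
  "that T31 * normal_monom a b c d = qscale (q_inv ^ a) (normal_monom a b (Suc c) d)"
  by (simp add: normal_monom_def mult.assoc mult_left_cong[OF qmink_power_relations(2)]
      mult_left_cong[OF qmink_power_relations(3)] qscale_mult_left)

text \<open>Without \<open>T41\<close> in the monomial, \<open>T32\<close> only has to pass
  generators with which it commutes up to a scalar.\<close>

lemma T32_mult_normal_0:
  "that T32 * normal_monom 0 b c d = qscale (q_inv ^ (b + c)) (normal_monom 0 b c (Suc d))"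
  by (simp add: normal_monom_def mult.assoc mult_left_cong[OF qmink_power_relations(4)]
      mult_left_cong[OF qmink_power_relations(5)] qscale_mult_left mult_qscale_right
      qscale_qscale power_add)

lemma that_mult_range_Q: "x \<in> range Q \<Longrightarrow> that v * x \<in> range Q"
proof -
  have T41: "x \<in> range Q \<Longrightarrow> that T41 * x \<in> range Q" for x
    by (rule mult_range_QI) (simp_all add: T41_mult_normal normal_monom_in_range_Q)
  have T42: "x \<in> range Q \<Longrightarrow> that T42 * x \<in> range Q" for x
    by (rule mult_range_QI) (simp_all add: T42_mult_normal normal_monom_in_range_Q range_Q_qscale)
  have T31: "x \<in> range Q \<Longrightarrow> that T31 * x \<in> range Q" for x
    by (rule mult_range_QI) (simp_all add: T31_mult_normal normal_monom_in_range_Q range_Q_qscale)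
  \<comment> \<open>Passing \<open>T32\<close> over one \<open>T41\<close> leaves a product with one
    \<open>T41\<close> fewer plus a \<open>T42 T31\<close> correction, which lies in the range by
    the cases already settled.\<close>
  have "that T32 * normal_monom a b c d \<in> range Q" for a b c d
  proof (induction a)
    case 0
    show ?case by (simp add: T32_mult_normal_0 normal_monom_in_range_Q range_Q_qscale)
  next
    case (Suc a)
    have "that T32 * normal_monom (Suc a) b c d
      = that T41 * (that T32 * normal_monom a b c d)
        + qscale (q_inv - q) (that T42 * (that T31 * normal_monom a b c d))"
      by (simp add: T41_mult_normal[symmetric] mult.assoc[symmetric] qmink_relations(3)
          distrib_right qscale_mult_left)
    then show ?case
      using Suc normal_monom_in_range_Q T41 T42 T31 by (simp add: range_Q_add range_Q_qscale)
  qed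
  then have T32: "x \<in> range Q \<Longrightarrow> that T32 * x \<in> range Q" for x
    by (rule mult_range_QI)
  show "x \<in> range Q \<Longrightarrow> that v * x \<in> range Q"
    by (cases v) (simp_all add: T41 T42 T31 T32)
qed

text \<open>The range contains 1 and is closed under sums, scalars and left multiplication by
  generators. Words arise by such multiplications and span the free algebra, hence their classes
  span the quotient.\<close>

lemma surj_Q: "surj Q"
proof -
  have words: "abs_qmink (Poly_Mapping.single (Word vs) 1) \<in> range Q" for vs
  proof (induction vs)
    case Nil
    have "abs_qmink (Poly_Mapping.single (Word []) 1) = normal_monom 0 0 0 0"
      by (simp add: normal_monom_def flip: one_qmink.abs_eq zero_word_def)
    then show ?case using normal_monom_in_range_Q[of 0 0 0 0] by simp
  next
    case (Cons v vs)
    have "Poly_Mapping.single (Word (v # vs)) 1 = letter v * Poly_Mapping.single (Word vs) 1"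
      by (simp add: letter_def mult_single plus_word_def)
    then have "abs_qmink (Poly_Mapping.single (Word (v # vs)) 1)
        = that v * abs_qmink (Poly_Mapping.single (Word vs) 1)"
      by (simp add: that.abs_eq times_qmink.abs_eq)
    with Cons that_mult_range_Q show ?case by simp
  qed
  have "abs_qmink a \<in> range Q" for a
  proof (induction a rule: poly_mapping_add_induct)
    case (single w c)
    have "Poly_Mapping.single w c = scalar c * Poly_Mapping.single w 1"
      by (simp add: scalar_def mult_single)
    then have "abs_qmink (Poly_Mapping.single w c)
        = qscale c (abs_qmink (Poly_Mapping.single w 1))"
      by (simp add: qscale.abs_eq)
    with words[of "letters w"] show ?case by (simp add: range_Q_qscale)
  next
    case (add a b)
    then show ?case by (simp add: plus_qmink.abs_eq[symmetric] range_Q_add)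
  qed
  then show ?thesis
    by (metis Quotient3_abs_rep Quotient3_qmink UNIV_eq_I)
qed

section \<open>First-order jets of the star product\<close>

text \<open>The candidate for the first-order term. Each summand differentiates \<open>f\<close> by
  a generator strictly later in the normal order than the one used for \<open>g\<close>: only
  out-of-order pairs need reordering. To first order \<open>q_inv\<close> is 1 - h and
  \<open>q_inv - q\<close> is -2h, whence the coefficients.\<close>

definition bider :: "(gen, complex) mpoly \<Rightarrow> (gen, complex) mpoly \<Rightarrow> (gen, complex) mpoly" where
  "bider f g = - (t41 * t31 * \<partial> T31 f * \<partial> T41 g
     + t42 * t41 * \<partial> T42 f * \<partial> T41 g
     + t32 * t42 * \<partial> T32 f * \<partial> T42 g
     + t32 * t31 * \<partial> T32 f * \<partial> T31 g
     + 2 * t42 * t31 * \<partial> T32 f * \<partial> T41 g)"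

lemma bider_add_left: "bider (f + g) k = bider f k + bider g k"
  by (simp add: bider_def algebra_simps)

lemma bider_add_right: "bider k (f + g) = bider k f + bider k g"
  by (simp add: bider_def algebra_simps)

lemma bider_mult_left: "bider (f * g) k = f * bider g k + bider f k * g"
  by (simp add: bider_def algebra_simps)

lemma bider_mult_right: "bider k (f * g) = f * bider k g + bider k f * g"
  by (simp add: bider_def algebra_simps)

lemma bider_Const [simp]: "bider (Const c) f = 0" "bider f (Const c) = 0"
  by (simp_all add: bider_def)

lemma bider_0_1 [simp]: "bider 0 f = 0" "bider f 0 = 0" "bider 1 f = 0" "bider f 1 = 0"
  by (simp_all add: bider_def)

datatype jet = Jet (val: "(gen, complex) mpoly") (der: "(gen, complex) mpoly")

text \<open>\<open>Jet f g\<close> stands for \<open>f + h g\<close> modulo \<open>h\<^sup>2\<close>. Biderivations are Hochschild cocycles,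
  so the deformed product is associative.\<close>

instantiation jet :: ring_1
begin

definition zero_jet :: jet where "0 = Jet 0 0"
definition one_jet :: jet where "1 = Jet 1 0"
definition plus_jet :: "jet \<Rightarrow> jet \<Rightarrow> jet" where "x + y = Jet (val x + val y) (der x + der y)"
definition uminus_jet :: "jet \<Rightarrow> jet" where "- x = Jet (- val x) (- der x)"
definition minus_jet :: "jet \<Rightarrow> jet \<Rightarrow> jet" where "x - y = Jet (val x - val y) (der x - der y)"
definition times_jet :: "jet \<Rightarrow> jet \<Rightarrow> jet" where
  "x * y = Jet (val x * val y) (val x * der y + der x * val y + bider (val x) (val y))"

instance
  by standard (simp_all add: zero_jet_def one_jet_def plus_jet_def uminus_jet_def minus_jet_def
      times_jet_def bider_add_left bider_add_right bider_mult_left bider_mult_right algebra_simps)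

end

section \<open>Laurent polynomials to first order in h\<close>

lemma h_expansion_lin_ext: "h_expansion = lin_ext (\<lambda>k c. fps_const c * fps_exp (of_int k))"
  by (simp add: fun_eq_iff h_expansion_def lin_ext_def)

lemma h_expansion_add: "h_expansion (a + b) = h_expansion a + h_expansion b"
  by (simp add: h_expansion_lin_ext lin_ext_add distrib_right flip: fps_const_add)

lemma h_expansion_mult: "h_expansion (a * b) = h_expansion a * h_expansion b"
  unfolding h_expansion_lin_ext
  by (rule lin_ext_mult)
    (simp_all add: distrib_left distrib_right fps_exp_add_mult mult_ac flip: fps_const_add fps_const_mult)

lemma h_expansion_single: "h_expansion (Poly_Mapping.single k c) = fps_const c * fps_exp (of_int k)"
  by (simp add: h_expansion_lin_ext lin_ext_single)

lemma h_expansion_0 [simp]: "h_expansion 0 = 0"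
  by (simp add: h_expansion_def)

lemma h_expansion_1 [simp]: "h_expansion 1 = 1"
  using h_expansion_single[of 0 1] by simp

definition jet_scalar :: "laurent \<Rightarrow> jet" where
  "jet_scalar c = Jet (Const (fps_nth (h_expansion c) 0)) (Const (fps_nth (h_expansion c) 1))"

lemma jet_scalar_0 [simp]: "jet_scalar 0 = 0"
  by (simp add: jet_scalar_def zero_jet_def)

lemma jet_scalar_1 [simp]: "jet_scalar 1 = 1"
  by (simp add: jet_scalar_def one_jet_def)

lemma jet_scalar_add: "jet_scalar (a + b) = jet_scalar a + jet_scalar b"
  by (simp add: jet_scalar_def h_expansion_add plus_jet_def Const_add)

lemma jet_scalar_mult: "jet_scalar (a * b) = jet_scalar a * jet_scalar b"
  by (simp add: jet_scalar_def h_expansion_mult times_jet_def Const_add Const_mult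
      fps_mult_nth_1)

text \<open>\<open>bider\<close> annihilates constants, so the deformation does not affect products
  with them.\<close>

lemma jet_scalar_commute: "jet_scalar c * x = x * jet_scalar c"
  by (simp add: jet_scalar_def times_jet_def mult.commute add.commute)

text \<open>The homomorphism given by the universal property of the free algebra. The order of the
  letters matters, since jets do not commute.\<close>

definition jet_eval :: "free_alg \<Rightarrow> jet" where
  "jet_eval = lin_ext (\<lambda>w c. jet_scalar c * prod_list (map (\<lambda>v. Jet (Var v) 0) (letters w)))"

lemma jet_eval_add: "jet_eval (a + b) = jet_eval a + jet_eval b"
  by (simp add: jet_eval_def lin_ext_add jet_scalar_add distrib_right)

lemma jet_eval_mult: "jet_eval (a * b) = jet_eval a * jet_eval b"
  unfolding jet_eval_def
proof (rule lin_ext_mult)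
  fix v w :: word and a b :: laurent
  let ?p = "\<lambda>w. prod_list (map (\<lambda>v. Jet (Var v) 0) (letters w))"
  have "jet_scalar (a * b) * ?p (v + w) = jet_scalar a * (jet_scalar b * ?p v) * ?p w"
    by (simp add: plus_word_def jet_scalar_mult mult.assoc)
  \<comment> \<open>Centrality of scalars carries the coefficient \<open>b\<close> across the value
    of the word \<open>v\<close>.\<close>
  also have "\<dots> = jet_scalar a * ?p v * (jet_scalar b * ?p w)"
    by (simp add: jet_scalar_commute[of b] mult.assoc)
  finally show "jet_scalar (a * b) * ?p (v + w) = jet_scalar a * ?p v * (jet_scalar b * ?p w)" .
qed (simp_all add: jet_scalar_add distrib_right)

lemma jet_eval_0 [simp]: "jet_eval 0 = 0"
  by (simp add: jet_eval_def lin_ext_def)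

lemma jet_eval_diff: "jet_eval (a - b) = jet_eval a - jet_eval b"
  using jet_eval_add[of "a - b" b] by simp

lemma jet_eval_scalar: "jet_eval (scalar c) = jet_scalar c"
  by (simp add: jet_eval_def lin_ext_single scalar_def zero_word_def)

lemma jet_eval_letter: "jet_eval (letter v) = Jet (Var v) 0"
  by (simp add: jet_eval_def lin_ext_single letter_def)

lemma jet_scalar_q: "jet_scalar q = Jet 1 1" "jet_scalar q_inv = Jet 1 (- 1)"
  by (simp_all add: jet_scalar_def q_def q_inv_def h_expansion_single Const_uminus)

text \<open>To first order the relations are what \<open>bider\<close> encodes: in an exchange by
  \<open>q_inv\<close> both sides have minus the product of the two generators as first-order part,
  and the correction for \<open>T32 T41\<close> gives \<open>-2 t42 t31\<close>, matching the last
  term of \<open>bider\<close>.\<close>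

lemma jet_eval_relators: "r \<in> relators \<Longrightarrow> jet_eval r = 0"
proof -
  have scalar_diff: "scalar (a - b) = scalar a - scalar b" for a b
    by (simp add: scalar_def single_diff)
  show "r \<in> relators \<Longrightarrow> jet_eval r = 0"
    by (auto simp: relators_def jet_eval_diff jet_eval_add jet_eval_mult jet_eval_scalar
        jet_eval_letter jet_scalar_q scalar_diff)
      (simp_all add: times_jet_def plus_jet_def minus_jet_def zero_jet_def bider_def
        bider_mult_left algebra_simps)
qed

lemma jet_eval_relation_ideal: "a \<in> relation_ideal \<Longrightarrow> jet_eval a = 0"
  by (induction rule: relation_ideal.induct)
    (simp_all add: jet_eval_relators jet_eval_add jet_eval_mult)

section \<open>The jet homomorphism on the quantum Minkowski space\<close>

lift_definition qmink_jet :: "qmink \<Rightarrow> jet" is jet_eval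
  by (metis ideal_cong_def jet_eval_diff jet_eval_relation_ideal eq_iff_diff_eq_0)

lemma qmink_jet_add: "qmink_jet (x + y) = qmink_jet x + qmink_jet y"
  by transfer (rule jet_eval_add)

lemma qmink_jet_mult: "qmink_jet (x * y) = qmink_jet x * qmink_jet y"
  by transfer (rule jet_eval_mult)

lemma qmink_jet_1: "qmink_jet 1 = 1"
  by transfer (simp add: jet_eval_scalar[of 1, unfolded scalar_def, simplified])

lemma qmink_jet_qscale: "qmink_jet (qscale c x) = jet_scalar c * qmink_jet x"
  by transfer (simp add: jet_eval_mult jet_eval_scalar)

lemma qmink_jet_that: "qmink_jet (that v) = Jet (Var v) 0"
  by transfer (rule jet_eval_letter)

text \<open>No summand of \<open>bider\<close> differentiates both arguments by the same
  generator.\<close>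

lemma Jet_power_Var: "Jet (Var v) 0 ^ n = Jet (Var v ^ n) 0"
proof (induction n)
  case (Suc n)
  have "bider (Var v) (Var v ^ n) = 0"
    by (cases v) (simp_all add: bider_def pdiff_power_zero)
  with Suc show ?case by (simp add: times_jet_def)
qed (simp add: one_jet_def)

lemma qmink_jet_power: "qmink_jet (x ^ n) = qmink_jet x ^ n"
  by (induction n) (simp_all add: qmink_jet_1 qmink_jet_mult)

text \<open>At each product of powers the right factor involves a generator later than all those on
  the left, while \<open>bider\<close> needs the opposite order.\<close>

lemma qmink_jet_normal_monom:
  "qmink_jet (normal_monom a b c d) = Jet (t41 ^ a * t42 ^ b * t31 ^ c * t32 ^ d) 0"
  by (simp add: normal_monom_def qmink_jet_mult qmink_jet_power qmink_jet_that Jet_power_Var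
      times_jet_def bider_def pdiff_power_zero)

lemma gen_monom_eq: "Poly_Mapping.single m (1::complex) =
    t41 ^ Poly_Mapping.lookup m T41 * t42 ^ Poly_Mapping.lookup m T42 *
    t31 ^ Poly_Mapping.lookup m T31 * t32 ^ Poly_Mapping.lookup m T32"
proof -
  have "m = Poly_Mapping.single T41 (Poly_Mapping.lookup m T41)
      + Poly_Mapping.single T42 (Poly_Mapping.lookup m T42)
      + Poly_Mapping.single T31 (Poly_Mapping.lookup m T31)
      + Poly_Mapping.single T32 (Poly_Mapping.lookup m T32)" (is "_ = ?m")
  proof (rule poly_mapping_eqI)
    fix v show "Poly_Mapping.lookup m v = Poly_Mapping.lookup ?m v"
      by (cases v) (simp_all add: lookup_add lookup_single)
  qed
  then have "Poly_Mapping.single m (1::complex) = Poly_Mapping.single ?m 1" by simp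
  then show ?thesis by (simp add: Var_power mult_single)
qed

abbreviation h_coeff :: "nat \<Rightarrow> (gen, laurent) mpoly \<Rightarrow> (gen, complex) mpoly" where
  "h_coeff n \<equiv> Poly_Mapping.map (\<lambda>c. fps_nth (h_expansion c) n)"

text \<open>\<open>Poly_Mapping.map\<close> acts on nonzero coefficients only; this agrees with
  acting on all, since zero expands to zero.\<close>

lemma lookup_h_coeff:
  "Poly_Mapping.lookup (h_coeff n F) m = fps_nth (h_expansion (Poly_Mapping.lookup F m)) n"
  by (simp add: Poly_Mapping.map.rep_eq when_def)

text \<open>Ordered monomials have no first-order part, so h enters the jet only through the
  coefficients.\<close>

lemma qmink_jet_Q: "qmink_jet (Q F) = Jet (h_coeff 0 F) (h_coeff 1 F)"
proof (induction F rule: poly_mapping_add_induct)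
  case (single m c)
  have "h_coeff n (Poly_Mapping.single m c)
      = Poly_Mapping.single m (fps_nth (h_expansion c) n)" for n
    by (rule poly_mapping_eqI) (simp add: lookup_h_coeff lookup_single when_def)
  moreover have "qmink_jet (Q (Poly_Mapping.single m c))
      = jet_scalar c * Jet (Poly_Mapping.single m 1) 0"
    by (simp add: Q_lin_ext lin_ext_single qmink_jet_qscale qmink_jet_normal_monom gen_monom_eq)
  ultimately show ?case
    by (simp add: jet_scalar_def times_jet_def Const_mult_single)
next
  case (add F G)
  have "h_coeff n (F + G) = h_coeff n F + h_coeff n G" for n
    by (rule poly_mapping_eqI) (simp add: lookup_h_coeff lookup_add h_expansion_add)
  with add show ?case by (simp add: Q_add qmink_jet_add plus_jet_def)
qed

lemma h_coeff_base_change: "h_coeff 0 (base_change f) = f" "h_coeff 1 (base_change f) = 0"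
proof -
  have "Poly_Mapping.lookup (base_change f) m = Poly_Mapping.single 0 (Poly_Mapping.lookup f m)"
    for m by (simp add: base_change_def Poly_Mapping.map.rep_eq when_def)
  then show "h_coeff 0 (base_change f) = f" "h_coeff 1 (base_change f) = 0"
    by (auto intro!: poly_mapping_eqI simp: lookup_h_coeff h_expansion_single)
qed

lemma C\<^sub>1_eq_bider: "C\<^sub>1 f g = bider f g"
proof -
  have "Q (base_change f \<star> base_change g) = Q (base_change f) * Q (base_change g)"
    unfolding star_def by (rule surj_f_inv_f[OF surj_Q])
  then have "qmink_jet (Q (base_change f \<star> base_change g))
      = qmink_jet (Q (base_change f)) * qmink_jet (Q (base_change g))"
    by (simp add: qmink_jet_mult)
  \<comment> \<open>Base changes have no first-order part, so the second component on the right is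
    \<open>bider f g\<close>; on the left it is \<open>C\<^sub>1 f g\<close>.\<close>
  then show ?thesis
    unfolding qmink_jet_Q h_coeff_base_change by (simp add: C\<^sub>1_def times_jet_def)
qed

section \<open>The Poisson bracket\<close>

lemma pbr_eq_bider: "pbr f g = bider f g - bider g f"
  by (simp add: pbr_def C\<^sub>1_eq_bider)

lemma pbr_add_left: "pbr (f + g) k = pbr f k + pbr g k"
  by (simp add: pbr_eq_bider bider_add_left bider_add_right)

lemma pbr_antisym: "pbr f g = - pbr g f"
  by (simp add: pbr_eq_bider)

lemma pbr_add_right: "pbr k (f + g) = pbr k f + pbr k g"
  by (simp add: pbr_eq_bider bider_add_left bider_add_right)

lemma pbr_mult_left: "pbr (f * g) k = f * pbr g k + pbr f k * g"
  by (simp add: pbr_eq_bider bider_mult_left bider_mult_right algebra_simps)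

lemma pbr_mult_right: "pbr k (f * g) = f * pbr k g + pbr k f * g"
  by (simp add: pbr_eq_bider bider_mult_left bider_mult_right algebra_simps)

lemma pbr_Const [simp]: "pbr (Const c) f = 0" "pbr f (Const c) = 0"
  by (simp_all add: pbr_eq_bider)

lemma pbr_0 [simp]: "pbr 0 f = 0" "pbr f 0 = 0"
  by (simp_all add: pbr_eq_bider)

text \<open>The coefficient 2 in the bracket of \<open>t41\<close> and \<open>t32\<close> reappears
  inside nested brackets.\<close>

lemma pbr_numeral_2 [simp]: "pbr f 2 = 0"
  using pbr_add_right[of f 1 1] pbr_Const(2)[of f 1] by simp

lemma pbr_uminus: "pbr (- f) g = - pbr f g" "pbr f (- g) = - pbr f g"
  by (simp_all add: pbr_eq_bider bider_def algebra_simps)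

lemma pbr_diff_right: "pbr k (f - g) = pbr k f - pbr k g"
  using pbr_add_right[of k f "- g"] by (simp add: pbr_uminus)

section \<open>The Jacobi identity\<close>

definition jacobiator :: "(gen, complex) mpoly \<Rightarrow> (gen, complex) mpoly \<Rightarrow>
    (gen, complex) mpoly \<Rightarrow> (gen, complex) mpoly" where
  "jacobiator f g k = pbr f (pbr g k) + pbr g (pbr k f) + pbr k (pbr f g)"

lemma jacobiator_cyclic: "jacobiator f g k = jacobiator g k f"
  by (simp add: jacobiator_def)

text \<open>Holds for any antisymmetric biderivation: the products of two brackets produced by the
  Leibniz rule cancel in pairs.\<close>

lemma jacobiator_mult:
  "jacobiator (f * f') g k = f * jacobiator f' g k + jacobiator f g k * f'"
proof -
  have "pbr g f = - pbr f g" "pbr g f' = - pbr f' g" by (rule pbr_antisym)+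
  then show ?thesis
    using pbr_antisym[of k f] pbr_antisym[of k f']
    by (simp add: jacobiator_def pbr_mult_left pbr_mult_right pbr_add_right pbr_diff_right
        pbr_uminus algebra_simps)
qed

text \<open>A derivation that kills the variables kills everything; on constants the brackets
  vanish.\<close>

lemma jacobiator_zeroI:
  assumes "\<And>v. jacobiator (Var v) g k = 0"
  shows "jacobiator f g k = 0"
proof (induction f rule: mpoly_induct)
  case (add a b)
  have "jacobiator (a + b) g k = jacobiator a g k + jacobiator b g k"
    by (simp add: jacobiator_def pbr_add_left pbr_add_right)
  with add show ?case by simp
qed (simp_all add: assms jacobiator_mult, simp add: jacobiator_def)

lemma pbr_gens:
  "pbr t41 t31 = t41 * t31" "pbr t41 t42 = t41 * t42" "pbr t42 t32 = t42 * t32"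
  "pbr t31 t32 = t31 * t32" "pbr t41 t32 = 2 * (t42 * t31)" "pbr t42 t31 = 0"
  "pbr t31 t41 = - (t41 * t31)" "pbr t42 t41 = - (t41 * t42)" "pbr t32 t42 = - (t42 * t32)"
  "pbr t32 t31 = - (t31 * t32)" "pbr t32 t41 = - (2 * (t42 * t31))" "pbr t31 t42 = 0"
  "pbr (Var v) (Var v) = 0"
  by (simp_all add: pbr_eq_bider bider_def mult_ac)

lemma jacobiator_gens: "jacobiator (Var u) (Var v) (Var w) = 0"
  by (cases u; cases v; cases w)
    (simp_all add: jacobiator_def pbr_gens pbr_mult_right pbr_uminus algebra_simps)

text \<open>Cyclic symmetry brings each argument in turn to the first place, where it can be reduced
  to a variable; three reductions leave triples of generators.\<close>

lemma jacobiator_zero: "jacobiator f g k = 0"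
proof (rule jacobiator_zeroI)
  fix u
  have "jacobiator g k (Var u) = 0"
  proof (rule jacobiator_zeroI)
    fix v
    have "jacobiator k (Var u) (Var v) = 0"
      by (rule jacobiator_zeroI) (rule jacobiator_gens)
    then show "jacobiator (Var v) k (Var u) = 0"
      by (simp only: jacobiator_cyclic[of "Var v"])
  qed
  then show "jacobiator (Var u) g k = 0"
    by (simp only: jacobiator_cyclic[of "Var u"])
qed

text \<open>Compatibility with scalars is the Leibniz rule together with the vanishing of brackets
  with constants.\<close>

lemma poisson_bracket_pbr: "poisson_bracket pbr"
  unfolding poisson_bracket_def
  by (intro conjI allI pbr_add_left pbr_antisym pbr_mult_left
      jacobiator_zero[unfolded jacobiator_def]) (simp add: pbr_mult_left)

section \<open>Space-time coordinates\<close>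

text \<open>The inverse of the linear substitution \<open>xc\<close>, found by solving its four
  equations for the generators.\<close>

primrec gen_in_x :: "gen \<Rightarrow> (coord, complex) mpoly" where
  "gen_in_x T41 = Var X1 + Const \<i> * Var X2"
| "gen_in_x T42 = Var X0 - Var X3"
| "gen_in_x T31 = Var X0 + Var X3"
| "gen_in_x T32 = Var X1 - Const \<i> * Var X2"

lemma Const_ii: "Const \<i> * Const \<i> = (-1 :: ('v, complex) mpoly)"
  by (simp flip: Const_mult add: Const_uminus)

lemma Const_ii_left: "Const \<i> * (Const \<i> * p) = - (p :: ('v, complex) mpoly)"
  by (simp flip: mult.assoc add: Const_ii)

lemma Const_ii_half: "Const (\<i>/2) = Const \<i> * Const (1/2)"
  by (simp flip: Const_mult)

lemma two_mult_Const_half: "2 * Const (1/2) = (1 :: ('v, complex) mpoly)"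
  by (simp add: mult_2 flip: Const_add)

lemma two_mult_mult_Const_half: "2 * (p * Const (1/2)) = (p :: ('v, complex) mpoly)"
  by (simp add: mult.left_commute[of 2] two_mult_Const_half)

lemma gen_eq_xc:
  "t41 = xc X1 + Const \<i> * xc X2" "t42 = xc X0 - xc X3"
  "t31 = xc X0 + xc X3" "t32 = xc X1 - Const \<i> * xc X2"
  by (simp_all add: Const_ii_half mult.assoc Const_ii_left)
    (simp_all add: algebra_simps two_mult_Const_half two_mult_mult_Const_half)

lemma psubst_xc_gen_in_x: "psubst xc (gen_in_x v) = Var v"
  by (cases v) (simp_all only: gen_in_x.simps psubst_add psubst_diff psubst_mult psubst_Const
      psubst_Var gen_eq_xc)

lemma psubst_gen_in_x_xc: "psubst gen_in_x (xc \<mu>) = Var \<mu>"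
  by (cases \<mu>) (simp_all add: Const_ii_half algebra_simps two_mult_Const_half
      Const_ii_left)

text \<open>Substitutions are ring homomorphisms fixing constants, so their composite is the
  identity once it fixes the variables.\<close>

lemma in_coords_gen_in_x: "in_coords (psubst gen_in_x f) = f"
  by (induction f rule: mpoly_induct) (simp_all add: in_coords_def psubst_xc_gen_in_x)

lemma gen_in_x_in_coords: "psubst gen_in_x (in_coords F) = F"
  by (induction F rule: mpoly_induct) (simp_all add: in_coords_def psubst_gen_in_x_xc)

text \<open>Makes \<open>inv in_coords\<close> in \<open>pdiff_x\<close> a genuine inverse: every
  polynomial has exactly one expression in the coordinates.\<close>

lemma bij_in_coords: "bij in_coords"
  by (metis bijI' in_coords_gen_in_x gen_in_x_in_coords)

lemma inv_in_coords: "inv in_coords = psubst gen_in_x"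
  by (metis bij_in_coords bij_inv_eq_iff ext in_coords_gen_in_x)

section \<open>Derivatives with respect to the space-time coordinates\<close>

lemma pdiff_x_eq: "\<partial>x \<mu> f = psubst xc (\<partial> \<mu> (psubst gen_in_x f))"
  by (simp add: pdiff_x_def inv_in_coords) (simp add: in_coords_def)

lemma pdiff_x_add: "\<partial>x \<mu> (f + g) = \<partial>x \<mu> f + \<partial>x \<mu> g"
  by (simp add: pdiff_x_eq)

lemma pdiff_x_mult: "\<partial>x \<mu> (f * g) = f * \<partial>x \<mu> g + \<partial>x \<mu> f * g"
  using in_coords_gen_in_x by (simp add: pdiff_x_eq in_coords_def)

text \<open>Both sides are derivations in \<open>f\<close> that vanish on constants and agree on the
  variables.\<close>

lemma pdiff_x_chain:
  "\<partial>x \<mu> f = (\<Sum>v\<in>{T41, T42, T31, T32}. \<partial>x \<mu> (Var v) * \<partial> v f)"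
proof (induction f rule: mpoly_induct)
  case (Const c)
  show ?case by (simp add: pdiff_x_eq)
next
  case (Var v)
  show ?case by (cases v) simp_all
qed (simp_all add: pdiff_x_add pdiff_x_mult algebra_simps)

lemma pdiff_x_simps:
  "\<partial>x X0 f = \<partial> T31 f + \<partial> T42 f"
  "\<partial>x X1 f = \<partial> T32 f + \<partial> T41 f"
  "\<partial>x X2 f = Const \<i> * (\<partial> T41 f - \<partial> T32 f)"
  "\<partial>x X3 f = \<partial> T31 f - \<partial> T42 f"
  by (subst pdiff_x_chain, simp add: pdiff_x_eq algebra_simps)+

theorem mainTheorem3:
  shows
    "(\<forall>f g. C\<^sub>1 f g =
        - (t41 * t31 * \<partial> T31 f * \<partial> T41 g
         + t42 * t41 * \<partial> T42 f * \<partial> T41 g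
         + t32 * t42 * \<partial> T32 f * \<partial> T42 g
         + t32 * t31 * \<partial> T32 f * \<partial> T31 g
         + 2 * t42 * t31 * \<partial> T32 f * \<partial> T41 g))
   \<and> poisson_bracket pbr
   \<and> (\<forall>f g. pbr f g =
          t41 * t31 * (\<partial> T41 f * \<partial> T31 g - \<partial> T41 g * \<partial> T31 f)
        + t42 * t41 * (\<partial> T41 f * \<partial> T42 g - \<partial> T41 g * \<partial> T42 f)
        + t32 * t42 * (\<partial> T42 f * \<partial> T32 g - \<partial> T42 g * \<partial> T32 f)
        + t32 * t31 * (\<partial> T31 f * \<partial> T32 g - \<partial> T31 g * \<partial> T32 f)
        + 2 * t42 * t31 * (\<partial> T41 f * \<partial> T32 g - \<partial> T41 g * \<partial> T32 f))
   \<and> bij in_coords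
   \<and> (\<forall>f g. pbr f g = Const \<i> *
         (((xc X0)^2 - (xc X3)^2) * (\<partial>x X1 f * \<partial>x X2 g - \<partial>x X1 g * \<partial>x X2 f)
        + xc X0 * xc X1 * (\<partial>x X0 f * \<partial>x X2 g - \<partial>x X0 g * \<partial>x X2 f)
        - xc X0 * xc X2 * (\<partial>x X0 f * \<partial>x X1 g - \<partial>x X0 g * \<partial>x X1 f)
        - xc X1 * xc X3 * (\<partial>x X2 f * \<partial>x X3 g - \<partial>x X2 g * \<partial>x X3 f)
        + xc X2 * xc X3 * (\<partial>x X1 f * \<partial>x X3 g - \<partial>x X1 g * \<partial>x X3 f)))"
proof (intro conjI allI poisson_bracket_pbr bij_in_coords)
  fix f g
  show "C\<^sub>1 f g = - (t41 * t31 * \<partial> T31 f * \<partial> T41 g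
         + t42 * t41 * \<partial> T42 f * \<partial> T41 g
         + t32 * t42 * \<partial> T32 f * \<partial> T42 g
         + t32 * t31 * \<partial> T32 f * \<partial> T31 g
         + 2 * t42 * t31 * \<partial> T32 f * \<partial> T41 g)"
    by (simp only: C\<^sub>1_eq_bider bider_def)
  show pbr: "pbr f g =
          t41 * t31 * (\<partial> T41 f * \<partial> T31 g - \<partial> T41 g * \<partial> T31 f)
        + t42 * t41 * (\<partial> T41 f * \<partial> T42 g - \<partial> T41 g * \<partial> T42 f)
        + t32 * t42 * (\<partial> T42 f * \<partial> T32 g - \<partial> T42 g * \<partial> T32 f)
        + t32 * t31 * (\<partial> T31 f * \<partial> T32 g - \<partial> T31 g * \<partial> T32 f)
        + 2 * t42 * t31 * (\<partial> T41 f * \<partial> T32 g - \<partial> T41 g * \<partial> T32 f)"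
    by (simp add: pbr_eq_bider bider_def algebra_simps)
  show "pbr f g = Const \<i> *
         (((xc X0)^2 - (xc X3)^2) * (\<partial>x X1 f * \<partial>x X2 g - \<partial>x X1 g * \<partial>x X2 f)
        + xc X0 * xc X1 * (\<partial>x X0 f * \<partial>x X2 g - \<partial>x X0 g * \<partial>x X2 f)
        - xc X0 * xc X2 * (\<partial>x X0 f * \<partial>x X1 g - \<partial>x X0 g * \<partial>x X1 f)
        - xc X1 * xc X3 * (\<partial>x X2 f * \<partial>x X3 g - \<partial>x X2 g * \<partial>x X3 f)
        + xc X2 * xc X3 * (\<partial>x X1 f * \<partial>x X3 g - \<partial>x X1 g * \<partial>x X3 f))"
    \<comment> \<open>With the \<open>xc\<close> left unexpanded, what remains is a polynomial
      identity in the \<open>xc\<close>, the derivatives by the generators and i, using only i^2 =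
      -1.\<close>
    unfolding pbr gen_eq_xc pdiff_x_simps
    by (simp del: xc.simps add: power2_eq_square algebra_simps Const_ii_left)
qed

end
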